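(* Suppose (OPT) has a feasible solution, and let $\mathcal P$ and the components $(\mathcal C_c(p^* ),\mathcal C_t(p^* ))$, $p^*\in\mathcal P$, be the set of bid values and the components obtained by the algorithm described in the context. For $p^*\in\mathcal P$ let $D_{p^*}(b)=\sum_{j\in\mathcal C_t(p^* )}D_j(b)$, $b\ge0$, and $I_{p^*}=\sum_{i\in\mathcal C_c(p^* )}I_i$. Let $s\in\mathcal S$ be a mixed strategy that is a solution to the optimization problem. Then $$C(s)\ \ge\ \sum_{p^*\in\mathcal P}\Big[I_{p^*}p^*-\int_0^{p^*}D_{p^*}(b)\,db\Big].$$
   Context: Model: $\mathcal N=\{1,\dots,N_c\}$ is a finite set of campaigns and $\mathcal T=\{1,\dots,N_r\}$ a finite set of targeting groups. Campaign $i$ requires $I_i\ge 0$ impressions and may bid only on the targeting groups in a given set $\mathcal A_i\subseteq\mathcal T$; for $j\in\mathcal T$ put $\mathcal B_j=\{i\in\mathcal N: j\in\mathcal A_i\}$, and every $\mathcal B_j$ is nonempty. Targeting group $j$ has a supply curve $D_j:[0,\infty)\to[0,\infty)$, non-decreasing and right-continuous (not necessarily continuous). Problem (OPT) (pure strategies): minimize $\sum_{i}\sum_{j\in\mathcal A_i}\gamma_{i,j}\big(D_j(b_{i,j})b_{i,j}-\int_0^{b_{i,j}}D_j(x)\,dx\big)$ over $b_{i,j}\ge0$, $\gamma_{i,j}\ge0$ subject to $\sum_{j\in\mathcal A_i}\gamma_{i,j}D_j(b_{i,j})\ge I_i$ for all $i\in\mathcal N$ and $\sum_{i\in\mathcal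 B_j}\gamma_{i,j}\le1$ for all $j\in\mathcal T$. Mixed strategies: a mixed strategy $s\in\mathcal S$ consists, for each $i\in\mathcal N$ and $j\in\mathcal A_i$, of a finite set $\mathcal P_{i,j}\subset[0,\infty)$ of bid values and fractions $\gamma_{i,j}(b)\ge0$, $b\in\mathcal P_{i,j}$. It is a solution to the optimization problem if $\sum_{j\in\mathcal A_i}\sum_{b\in\mathcal P_{i,j}}\gamma_{i,j}(b)D_j(b)\ge I_i$ for all $i\in\mathcal N$ and $\sum_{i\in\mathcal B_j}\sum_{b\in\mathcal P_{i,j}}\gamma_{i,j}(b)\le1$ for all $j\in\mathcal T$. Its cost is $$C(s)=\sum_{i\in\mathcal N}\sum_{j\in\mathcal A_i}\sum_{b\in\mathcal P_{i,j}}\gamma_{i,j}(b)\Big(D_j(b)b-\int_0^bD_j(x)\,dx\Big).$$ Algorithm. For $\mathcal C_c\subseteq\mathcal N$, $\mathcal C_t\subseteq\mathcal T$: PRICE$(\mathcal C_c,\mathcal C_t)$ is the unique $p\ge0$ with $\sum_{j\in\mathcal C_t}D_j(p)\ge\sum_{i\in\mathcal C_c}I_i$ and $\sum_{j\in\mathcal C_t}D_j(b)<\sum_{i\in\mathcal C_c}I_i$ for all $0\le b<p$. ALLOC$(\mathcal C_c,\mathcal C_t,p)$ is the convex problem of minimizing $\sum_{i\in\mathcal C_c}\big(I_i-\sum_{j\in\mathcal A_i\cap\mathcal C_t}t_{i,j}D_j(p)\big)^2$ over $t_{i,j}\ge0$ ($i\in\mathcal C_c$, $j\in\mathcal A_i\cap\mathcal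 C_t$; $t_{i,j}=0$ otherwise) subject to $\sum_{i\in\mathcal B_j\cap\mathcal C_c}t_{i,j}\le1$ for $j\in\mathcal C_t$. The recursive procedure REC$(\mathcal C_c,\mathcal C_t)$: compute $p=$ PRICE$(\mathcal C_c,\mathcal C_t)$ and an (arbitrary) optimal solution $t^*$ of ALLOC$(\mathcal C_c,\mathcal C_t,p)$. If its optimal value is $0$, stop and output the single component $(\mathcal C_c,\mathcal C_t)$ with bid value $p$. Otherwise (SPLIT) set $\mathcal C_c^{(1)}=\{i\in\mathcal C_c: I_i\ne\sum_{j\in\mathcal A_i\cap\mathcal C_t}t^*_{i,j}D_j(p)\}$, $\mathcal C_t^{(1)}=\mathcal C_t\cap\bigcup_{i\in\mathcal C_c^{(1)}}\mathcal A_i$, $\mathcal C_c^{(2)}=\mathcal C_c\setminus\mathcal C_c^{(1)}$, $\mathcal C_t^{(2)}=\mathcal C_t\setminus\mathcal C_t^{(1)}$, and output all components output by REC$(\mathcal C_c^{(1)},\mathcal C_t^{(1)})$ and REC$(\mathcal C_c^{(2)},\mathcal C_t^{(2)})$. Run REC$(\mathcal N,\mathcal T)$. Let $\mathcal P$ be the set of bid values of the output components; the components are indexed by their bid values $p^*\in\mathcal P$ and written $(\mathcal C_c(p^* ),\mathcal C_t(p^* ))$. *)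

theory Defs
  imports "HOL-Analysis.Analysis"
begin

text \<open>
  Campaigns are \<open>{1..Nc}\<close> and targeting groups are \<open>{1..Nr}\<close>.  A supply curve \<open>D j\<close> is a total
  function on the reals, but only its values on \<open>{0..}\<close> are ever used.
\<close>

definition bidders :: "nat \<Rightarrow> (nat \<Rightarrow> nat set) \<Rightarrow> nat \<Rightarrow> nat set" where
  "bidders Nc A j = {i \<in> {1..Nc}. j \<in> A i}"

definition supply_curve :: "(real \<Rightarrow> real) \<Rightarrow> bool" where
  "supply_curve d \<longleftrightarrow>
     (\<forall>x\<ge>0. d x \<ge> 0) \<and> mono_on {0..} d \<and> (\<forall>x\<ge>0. continuous (at_right x) d)"

definition bid_cost :: "(real \<Rightarrow> real) \<Rightarrow> real \<Rightarrow> real" where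
  "bid_cost d b = d b * b - integral {0..b} d"

definition opt_feasible ::
  "nat \<Rightarrow> nat \<Rightarrow> (nat \<Rightarrow> real) \<Rightarrow> (nat \<Rightarrow> nat set) \<Rightarrow> (nat \<Rightarrow> real \<Rightarrow> real) \<Rightarrow>
   (nat \<Rightarrow> nat \<Rightarrow> real) \<Rightarrow> (nat \<Rightarrow> nat \<Rightarrow> real) \<Rightarrow> bool" where
  "opt_feasible Nc Nr I A D b \<gamma> \<longleftrightarrow>
     (\<forall>i\<in>{1..Nc}. \<forall>j\<in>A i. b i j \<ge> 0 \<and> \<gamma> i j \<ge> 0) \<and>
     (\<forall>i\<in>{1..Nc}. (\<Sum>j\<in>A i. \<gamma> i j * D j (b i j)) \<ge> I i) \<and>
     (\<forall>j\<in>{1..Nr}. (\<Sum>i\<in>bidders Nc A j. \<gamma> i j) \<le> 1)"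

text \<open>
  A mixed strategy is given by the finite sets \<open>P i j\<close> of bid values and the fractions
  \<open>\<gamma> i j b\<close> for \<open>b \<in> P i j\<close>, where \<open>i\<close> is a campaign and \<open>j \<in> A i\<close>; all other values
  of \<open>P\<close> and \<open>\<gamma>\<close> are irrelevant.
\<close>

definition mixed_strategy ::
  "nat \<Rightarrow> (nat \<Rightarrow> nat set) \<Rightarrow>
   (nat \<Rightarrow> nat \<Rightarrow> real set) \<Rightarrow> (nat \<Rightarrow> nat \<Rightarrow> real \<Rightarrow> real) \<Rightarrow> bool" where
  "mixed_strategy Nc A P \<gamma> \<longleftrightarrow>
     (\<forall>i\<in>{1..Nc}. \<forall>j\<in>A i. finite (P i j) \<and> P i j \<subseteq> {0..} \<and> (\<forall>b\<in>P i j. \<gamma> i j b \<ge> 0))"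

definition mixed_solution ::
  "nat \<Rightarrow> nat \<Rightarrow> (nat \<Rightarrow> real) \<Rightarrow> (nat \<Rightarrow> nat set) \<Rightarrow> (nat \<Rightarrow> real \<Rightarrow> real) \<Rightarrow>
   (nat \<Rightarrow> nat \<Rightarrow> real set) \<Rightarrow> (nat \<Rightarrow> nat \<Rightarrow> real \<Rightarrow> real) \<Rightarrow> bool" where
  "mixed_solution Nc Nr I A D P \<gamma> \<longleftrightarrow>
     (\<forall>i\<in>{1..Nc}. (\<Sum>j\<in>A i. \<Sum>b\<in>P i j. \<gamma> i j b * D j b) \<ge> I i) \<and>
     (\<forall>j\<in>{1..Nr}. (\<Sum>i\<in>bidders Nc A j. \<Sum>b\<in>P i j. \<gamma> i j b) \<le> 1)"

definition mixed_cost ::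
  "nat \<Rightarrow> (nat \<Rightarrow> nat set) \<Rightarrow> (nat \<Rightarrow> real \<Rightarrow> real) \<Rightarrow>
   (nat \<Rightarrow> nat \<Rightarrow> real set) \<Rightarrow> (nat \<Rightarrow> nat \<Rightarrow> real \<Rightarrow> real) \<Rightarrow> real" where
  "mixed_cost Nc A D P \<gamma> =
     (\<Sum>i\<in>{1..Nc}. \<Sum>j\<in>A i. \<Sum>b\<in>P i j. \<gamma> i j b * bid_cost (D j) b)"

definition is_price ::
  "(nat \<Rightarrow> real) \<Rightarrow> (nat \<Rightarrow> real \<Rightarrow> real) \<Rightarrow> nat set \<Rightarrow> nat set \<Rightarrow> real \<Rightarrow> bool" where
  "is_price I D Cc Ct p \<longleftrightarrow>
     p \<ge> 0 \<and> (\<Sum>j\<in>Ct. D j p) \<ge> (\<Sum>i\<in>Cc. I i) \<and>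
     (\<forall>b. 0 \<le> b \<and> b < p \<longrightarrow> (\<Sum>j\<in>Ct. D j b) < (\<Sum>i\<in>Cc. I i))"

definition allocated ::
  "(nat \<Rightarrow> nat set) \<Rightarrow> (nat \<Rightarrow> real \<Rightarrow> real) \<Rightarrow> nat set \<Rightarrow> real \<Rightarrow>
   (nat \<Rightarrow> nat \<Rightarrow> real) \<Rightarrow> nat \<Rightarrow> real" where
  "allocated A D Ct p t i = (\<Sum>j\<in>A i \<inter> Ct. t i j * D j p)"

definition alloc_feasible ::
  "nat \<Rightarrow> (nat \<Rightarrow> nat set) \<Rightarrow> nat set \<Rightarrow> nat set \<Rightarrow> (nat \<Rightarrow> nat \<Rightarrow> real) \<Rightarrow> bool" where
  "alloc_feasible Nc A Cc Ct t \<longleftrightarrow>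
     (\<forall>i j. t i j \<ge> 0) \<and>
     (\<forall>i j. \<not> (i \<in> Cc \<and> j \<in> A i \<inter> Ct) \<longrightarrow> t i j = 0) \<and>
     (\<forall>j\<in>Ct. (\<Sum>i\<in>bidders Nc A j \<inter> Cc. t i j) \<le> 1)"

definition alloc_value ::
  "(nat \<Rightarrow> real) \<Rightarrow> (nat \<Rightarrow> nat set) \<Rightarrow> (nat \<Rightarrow> real \<Rightarrow> real) \<Rightarrow>
   nat set \<Rightarrow> nat set \<Rightarrow> real \<Rightarrow> (nat \<Rightarrow> nat \<Rightarrow> real) \<Rightarrow> real" where
  "alloc_value I A D Cc Ct p t = (\<Sum>i\<in>Cc. (I i - allocated A D Ct p t i)\<^sup>2)"

definition alloc_optimal ::
  "nat \<Rightarrow> (nat \<Rightarrow> real) \<Rightarrow> (nat \<Rightarrow> nat set) \<Rightarrow> (nat \<Rightarrow> real \<Rightarrow> real) \<Rightarrow>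
   nat set \<Rightarrow> nat set \<Rightarrow> real \<Rightarrow> (nat \<Rightarrow> nat \<Rightarrow> real) \<Rightarrow> bool" where
  "alloc_optimal Nc I A D Cc Ct p t \<longleftrightarrow>
     alloc_feasible Nc A Cc Ct t \<and>
     (\<forall>u. alloc_feasible Nc A Cc Ct u \<longrightarrow>
        alloc_value I A D Cc Ct p t \<le> alloc_value I A D Cc Ct p u)"

text \<open>
  A component is a triple of its bid value, its campaigns and its targeting groups.
  \<open>rec_output Nc I A D Cc Ct out\<close> says that some terminating run of the recursive procedure on
  \<open>(Cc, Ct)\<close> outputs exactly the components in \<open>out\<close>.  It is a relation and not a function because
  each call may use an arbitrary optimal solution \<open>t\<close> of the allocation problem.
\<close>

inductive rec_output ::
  "nat \<Rightarrow> (nat \<Rightarrow> real) \<Rightarrow> (nat \<Rightarrow> nat set) \<Rightarrow> (nat \<Rightarrow> real \<Rightarrow> real) \<Rightarrow>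
   nat set \<Rightarrow> nat set \<Rightarrow> (real \<times> nat set \<times> nat set) set \<Rightarrow> bool"
  for Nc I A D where
  stop: "\<lbrakk>is_price I D Cc Ct p; alloc_optimal Nc I A D Cc Ct p t;
          alloc_value I A D Cc Ct p t = 0\<rbrakk>
         \<Longrightarrow> rec_output Nc I A D Cc Ct {(p, Cc, Ct)}"
| split: "\<lbrakk>is_price I D Cc Ct p; alloc_optimal Nc I A D Cc Ct p t;
          alloc_value I A D Cc Ct p t \<noteq> 0;
          Cc1 = {i \<in> Cc. I i \<noteq> allocated A D Ct p t i};
          Ct1 = Ct \<inter> (\<Union>i\<in>Cc1. A i);
          rec_output Nc I A D Cc1 Ct1 out1;
          rec_output Nc I A D (Cc - Cc1) (Ct - Ct1) out2\<rbrakk>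
         \<Longrightarrow> rec_output Nc I A D Cc Ct (out1 \<union> out2)"

definition bid_values :: "(real \<times> nat set \<times> nat set) set \<Rightarrow> real set" where
  "bid_values out = fst ` out"

text \<open>
  Distinct components output by a run have distinct bid values, so the descriptions below
  are proper whenever \<open>p \<in> bid_values out\<close>.
\<close>

definition component :: "(real \<times> nat set \<times> nat set) set \<Rightarrow> real \<Rightarrow> nat set \<times> nat set" where
  "component out p = (THE c. (p, c) \<in> out)"

definition comp_campaigns :: "(real \<times> nat set \<times> nat set) set \<Rightarrow> real \<Rightarrow> nat set" where
  "comp_campaigns out p = fst (component out p)"

definition comp_groups :: "(real \<times> nat set \<times> nat set) set \<Rightarrow> real \<Rightarrow> nat set" where
  "comp_groups out p = snd (component out p)"

end

theory Submission imports Defs begin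

text \<open>
  Weak duality.  Since \<open>D j\<close> is monotone,
  \<open>bid_cost (D j) b \<ge> D j b * q - integral {0..q} (D j)\<close> for every price \<open>q \<ge> 0\<close>.  Apply this with
  \<open>q = \<kappa> i\<close>, the bid value of the component of campaign \<open>i\<close>, and sum with the weights of the
  mixed strategy.  The demand constraints turn the first part into \<open>\<Sum>i. I i * \<kappa> i\<close>, and the supply
  constraints bound the second one by \<open>\<Sum>j. integral {0..\<mu> j} (D j)\<close>, where \<open>\<mu> j\<close> is the bid value of
  the component of group \<open>j\<close>, as soon as \<open>\<kappa> i \<le> \<mu> j\<close> for all \<open>j \<in> A i\<close>.

  This inequality holds because a split at price \<open>p\<close> produces components with prices \<open>> p\<close> from the
  first call and \<open>\<le> p\<close> from the second one, while campaigns of the first call have no access to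
  groups of the second one.  The price bounds are propagated through the recursion as
  Hall-type conditions on \<open>(Cc, Ct)\<close>, which optimality of the allocation yields at each split.
\<close>

section \<open>Supply curves and the cost of a bid\<close>

lemma supply_integrable:
  assumes "supply_curve d" "0 \<le> a"
  shows "d integrable_on {a..b}"
proof -
  have "mono_on {a..b} d"
    using assms unfolding supply_curve_def by (auto intro: mono_on_subset)
  then show ?thesis
    by (rule integrable_on_mono_on)
qed

lemma supply_nonneg: "supply_curve d \<Longrightarrow> 0 \<le> x \<Longrightarrow> 0 \<le> d x"
  by (simp add: supply_curve_def)

lemma supply_mono: "supply_curve d \<Longrightarrow> 0 \<le> x \<Longrightarrow> x \<le> y \<Longrightarrow> d x \<le> d y"
  unfolding supply_curve_def by (rule mono_onD[of "{0..}"]) simp_all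

lemma supply_integral_mono:
  assumes d: "supply_curve d" and "0 \<le> q" "q \<le> r"
  shows "integral {0..q} d \<le> integral {0..r} d"
  using assms by (intro integral_subset_le) (auto intro: supply_integrable supply_nonneg)

text \<open>The right side minus the left side is the integral of \<open>d b - d x\<close> over
  \<open>{q..b}\<close> if \<open>q \<le> b\<close>, and of \<open>d x - d b\<close> over
  \<open>{b..q}\<close> otherwise. Both integrands are nonnegative by monotonicity.\<close>

lemma bid_cost_ge:
  assumes d: "supply_curve d" and b: "0 \<le> b" and q: "0 \<le> q"
  shows "d b * q - integral {0..q} d \<le> bid_cost d b"
proof (cases "q \<le> b")
  case True
  have "integral {0..b} d = integral {0..q} d + integral {q..b} d"
    using True q d by (intro Henstock_Kurzweil_Integration.integral_combine[symmetric] supply_integrable) auto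
  moreover have "integral {q..b} d \<le> integral {q..b} (\<lambda>_. d b)"
    using d q by (intro integral_le supply_integrable integrable_const_ivl) (auto intro: supply_mono)
  ultimately show ?thesis
    using True by (simp add: bid_cost_def algebra_simps)
next
  case False
  have "integral {0..q} d = integral {0..b} d + integral {b..q} d"
    using False b d by (intro Henstock_Kurzweil_Integration.integral_combine[symmetric] supply_integrable) auto
  moreover have "integral {b..q} (\<lambda>_. d b) \<le> integral {b..q} d"
    using d b by (intro integral_le supply_integrable integrable_const_ivl) (auto intro: supply_mono)
  ultimately show ?thesis
    using False by (simp add: bid_cost_def algebra_simps)
qed

section \<open>Weak duality for mixed strategies\<close>

locale market =
  fixes Nc Nr :: nat
    and I :: "nat \<Rightarrow> real"
    and A :: "nat \<Rightarrow> nat set"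
    and D :: "nat \<Rightarrow> real \<Rightarrow> real"
  assumes demand_nonneg: "\<And>i. i \<in> {1..Nc} \<Longrightarrow> 0 \<le> I i"
    and groups: "\<And>i. i \<in> {1..Nc} \<Longrightarrow> A i \<subseteq> {1..Nr}"
    and supply_D: "\<And>j. j \<in> {1..Nr} \<Longrightarrow> supply_curve (D j)"
begin

text \<open>Viewed as a linear program in the fractions, the problem has \<open>\<kappa> i\<close>
  as multiplier of the demand constraint of \<open>i\<close> and
  \<open>integral {0..\<mu> j} (D j)\<close> as multiplier of the supply constraint of
  \<open>j\<close>; \<open>term_ge\<close> is dual feasibility.\<close>

lemma weak_duality:
  fixes \<kappa> \<mu> :: "nat \<Rightarrow> real"
  assumes strat: "mixed_strategy Nc A P \<gamma>"
    and sol: "mixed_solution Nc Nr I A D P \<gamma>"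
    and \<kappa>: "\<And>i. i \<in> {1..Nc} \<Longrightarrow> 0 \<le> \<kappa> i"
    and \<mu>: "\<And>j. j \<in> {1..Nr} \<Longrightarrow> 0 \<le> \<mu> j"
    and le: "\<And>i j. i \<in> {1..Nc} \<Longrightarrow> j \<in> A i \<Longrightarrow> \<kappa> i \<le> \<mu> j"
  shows "(\<Sum>i\<in>{1..Nc}. I i * \<kappa> i) - (\<Sum>j\<in>{1..Nr}. integral {0..\<mu> j} (D j)) \<le> mixed_cost Nc A D P \<gamma>"
proof -
  define F where "F j = integral {0..\<mu> j} (D j)" for j
  define g where "g i j = (\<Sum>b\<in>P i j. \<gamma> i j b)" for i j
  have F: "0 \<le> F j" if "j \<in> {1..Nr}" for j
    unfolding F_def using that supply_D[OF that] \<mu>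
    by (intro integral_nonneg supply_integrable) (auto intro: supply_nonneg)
  have term_ge: "\<gamma> i j b * D j b * \<kappa> i - \<gamma> i j b * F j \<le> \<gamma> i j b * bid_cost (D j) b"
    if i: "i \<in> {1..Nc}" and j: "j \<in> A i" and b: "b \<in> P i j" for i j b
  proof -
    have dj: "supply_curve (D j)" using i j groups supply_D by blast
    have b0: "0 \<le> b" and \<gamma>0: "0 \<le> \<gamma> i j b"
      using strat i j b unfolding mixed_strategy_def by blast+
    \<comment> \<open>The order of \<open>\<kappa> i\<close> and \<open>\<mu> j\<close> enters here:
      it lets the multiplier \<open>F j\<close>, which must not depend on \<open>i\<close>, replace
      the integral up to \<open>\<kappa> i\<close>.\<close>
    have "D j b * \<kappa> i - F j \<le> D j b * \<kappa> i - integral {0..\<kappa> i} (D j)"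
      unfolding F_def using supply_integral_mono[OF dj \<kappa>[OF i] le[OF i j]] by simp
    also have "\<dots> \<le> bid_cost (D j) b"
      by (rule bid_cost_ge[OF dj b0 \<kappa>[OF i]])
    finally have "\<gamma> i j b * (D j b * \<kappa> i - F j) \<le> \<gamma> i j b * bid_cost (D j) b"
      using \<gamma>0 by (rule mult_left_mono)
    then show ?thesis by (simp add: algebra_simps)
  qed
  have "(\<Sum>i\<in>{1..Nc}. \<Sum>j\<in>A i. g i j * F j) = (\<Sum>i\<in>{1..Nc}. \<Sum>j\<in>{j\<in>{1..Nr}. j \<in> A i}. g i j * F j)"
    using groups by (intro sum.cong refl) blast
  also have "\<dots> = (\<Sum>j\<in>{1..Nr}. \<Sum>i\<in>bidders Nc A j. g i j * F j)"
    unfolding bidders_def by (rule sum.swap_restrict) auto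
  also have "\<dots> = (\<Sum>j\<in>{1..Nr}. (\<Sum>i\<in>bidders Nc A j. g i j) * F j)"
    by (simp add: sum_distrib_right)
  also have "\<dots> \<le> (\<Sum>j\<in>{1..Nr}. 1 * F j)"
    using sol F unfolding mixed_solution_def g_def
    by (intro sum_mono mult_right_mono) auto
  finally have supply_part: "(\<Sum>i\<in>{1..Nc}. \<Sum>j\<in>A i. g i j * F j) \<le> (\<Sum>j\<in>{1..Nr}. F j)"
    by simp
  have "(\<Sum>i\<in>{1..Nc}. I i * \<kappa> i)
      \<le> (\<Sum>i\<in>{1..Nc}. (\<Sum>j\<in>A i. \<Sum>b\<in>P i j. \<gamma> i j b * D j b) * \<kappa> i)"
    using sol \<kappa> unfolding mixed_solution_def by (intro sum_mono mult_right_mono) auto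
  then have "(\<Sum>i\<in>{1..Nc}. I i * \<kappa> i) - (\<Sum>j\<in>{1..Nr}. F j)
      \<le> (\<Sum>i\<in>{1..Nc}. (\<Sum>j\<in>A i. \<Sum>b\<in>P i j. \<gamma> i j b * D j b) * \<kappa> i)
        - (\<Sum>i\<in>{1..Nc}. \<Sum>j\<in>A i. g i j * F j)"
    using supply_part by linarith
  also have "\<dots> = (\<Sum>i\<in>{1..Nc}. \<Sum>j\<in>A i. \<Sum>b\<in>P i j. \<gamma> i j b * D j b * \<kappa> i - \<gamma> i j b * F j)"
    by (simp add: g_def sum_distrib_right sum_subtractf)
  also have "\<dots> \<le> mixed_cost Nc A D P \<gamma>"
    unfolding mixed_cost_def by (intro sum_mono term_ge)
  finally show ?thesis by (simp add: F_def)
qed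

end

section \<open>Exchange arguments for an optimal allocation at a fixed price\<close>

locale allocation = market +
  fixes Cc Ct :: "nat set" and p :: real and t :: "nat \<Rightarrow> nat \<Rightarrow> real"
  assumes Cc: "Cc \<subseteq> {1..Nc}" and Ct: "Ct \<subseteq> {1..Nr}"
    and price: "is_price I D Cc Ct p"
    and optimal: "alloc_optimal Nc I A D Cc Ct p t"
begin

abbreviation alloc :: "nat \<Rightarrow> real" where
  "alloc \<equiv> allocated A D Ct p t"

lemma finite_Cc: "finite Cc" and finite_Ct: "finite Ct"
  using Cc Ct by (auto intro: finite_subset)

lemma bidders_eq: "bidders Nc A j \<inter> Cc = {i \<in> Cc. j \<in> A i}"
  using Cc by (auto simp: bidders_def)

lemma supply_price_nonneg: "j \<in> Ct \<Longrightarrow> 0 \<le> D j p"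
  using price Ct by (intro supply_nonneg[OF supply_D]) (auto simp: is_price_def)

lemma feasible: "alloc_feasible Nc A Cc Ct t"
  using optimal by (simp add: alloc_optimal_def)

lemma t_nonneg: "0 \<le> t i j"
  and t_eq_0: "\<not> (i \<in> Cc \<and> j \<in> A i \<and> j \<in> Ct) \<Longrightarrow> t i j = 0"
  using feasible by (auto simp: alloc_feasible_def)

lemma column_eq: "(\<Sum>i\<in>bidders Nc A j \<inter> Cc. t i j) = (\<Sum>i\<in>Cc. t i j)"
  unfolding bidders_eq by (rule sum.mono_neutral_left) (auto simp: finite_Cc intro: t_eq_0)

lemma column_le: "j \<in> Ct \<Longrightarrow> (\<Sum>i\<in>Cc. t i j) \<le> 1"
  using feasible by (auto simp: alloc_feasible_def column_eq)

lemma alloc_eq: "alloc i = (\<Sum>j\<in>Ct. t i j * D j p)"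
  unfolding allocated_def by (rule sum.mono_neutral_left) (auto simp: finite_Ct intro: t_eq_0)

lemma not_improvable:
  assumes "alloc_feasible Nc A Cc Ct u"
  shows "(\<Sum>i\<in>Cc. (I i - alloc i)\<^sup>2) \<le> (\<Sum>i\<in>Cc. (I i - allocated A D Ct p u i)\<^sup>2)"
  using assms optimal by (simp add: alloc_optimal_def alloc_value_def)

text \<open>Scaling the row of an oversupplied campaign by \<open>I i / alloc i\<close> stays
  feasible, makes its squared error vanish and leaves all other errors unchanged.\<close>

lemma alloc_le:
  assumes i: "i \<in> Cc"
  shows "alloc i \<le> I i"
proof (rule ccontr)
  assume "\<not> alloc i \<le> I i"
  then have gt: "I i < alloc i" by simp
  have I0: "0 \<le> I i" using i Cc demand_nonneg by blast
  define c where "c = I i / alloc i"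
  have c: "0 \<le> c" "c \<le> 1" using gt I0 by (auto simp: c_def)
  define u where "u k j = (if k = i then c * t k j else t k j)" for k j
  have u_le: "u k j \<le> t k j" for k j
    using c t_nonneg by (auto simp: u_def intro: mult_left_le_one_le)
  have "(\<Sum>k\<in>bidders Nc A j \<inter> Cc. u k j) \<le> 1" if "j \<in> Ct" for j
    using sum_mono[of "bidders Nc A j \<inter> Cc" "\<lambda>k. u k j" "\<lambda>k. t k j"] u_le column_le[OF that]
    by (simp add: column_eq)
  then have "alloc_feasible Nc A Cc Ct u"
    using c t_nonneg by (auto simp: alloc_feasible_def u_def t_eq_0)
  from not_improvable[OF this]
  have "(\<Sum>k\<in>Cc. (I k - alloc k)\<^sup>2) \<le> (\<Sum>k\<in>Cc. (I k - allocated A D Ct p u k)\<^sup>2)" .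
  moreover have "allocated A D Ct p u k = alloc k" if "k \<noteq> i" for k
    using that by (simp add: allocated_def u_def)
  moreover have "allocated A D Ct p u i = c * alloc i"
    by (simp add: allocated_def u_def sum_distrib_left mult.assoc)
  then have "allocated A D Ct p u i = I i"
    using gt I0 by (simp add: c_def)
  ultimately have "(I i - alloc i)\<^sup>2 \<le> 0"
    using i finite_Cc by (simp add: sum.remove[of Cc i])
  then show False using gt by simp
qed

lemma allocated_update:
  assumes "j \<in> A i \<inter> Ct" and "\<And>l. l \<noteq> j \<Longrightarrow> u i l = t i l" and "u i j = t i j + e"
  shows "allocated A D Ct p u i = alloc i + e * D j p"
proof -
  have fin: "finite (A i \<inter> Ct)" using finite_Ct by simp
  have "(\<Sum>l\<in>A i \<inter> Ct - {j}. u i l * D l p) = (\<Sum>l\<in>A i \<inter> Ct - {j}. t i l * D l p)"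
    using assms(2) by (intro sum.cong) auto
  then show ?thesis
    unfolding allocated_def sum.remove[OF fin assms(1)] using assms(3) by (simp add: algebra_simps)
qed

lemma full_column:
  assumes i: "i \<in> Cc" and under: "alloc i < I i" and j: "j \<in> A i \<inter> Ct" and Dj: "0 < D j p"
  shows "(\<Sum>k\<in>Cc. t k j) = 1"
proof (rule ccontr)
  assume "(\<Sum>k\<in>Cc. t k j) \<noteq> 1"
  then have slack: "(\<Sum>k\<in>Cc. t k j) < 1" using column_le j by force
  \<comment> \<open>The first bound keeps column \<open>j\<close> feasible; the second keeps
    \<open>alloc i\<close> from overshooting \<open>I i\<close>, so the squared error of
    \<open>i\<close> strictly drops.\<close>
  define e where "e = min (1 - (\<Sum>k\<in>Cc. t k j)) ((I i - alloc i) / D j p)"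
  have e: "0 < e" "e \<le> 1 - (\<Sum>k\<in>Cc. t k j)" "e \<le> (I i - alloc i) / D j p"
    using slack under Dj by (auto simp: e_def)
  then have eD: "0 < e * D j p" "e * D j p \<le> I i - alloc i"
    using Dj by (auto simp: pos_le_divide_eq)
  define u where "u k l = t k l + (if k = i \<and> l = j then e else 0)" for k l
  have "(\<Sum>k\<in>bidders Nc A l \<inter> Cc. u k l) \<le> 1" if "l \<in> Ct" for l
  proof (cases "l = j")
    case True
    have "(\<Sum>k\<in>bidders Nc A l \<inter> Cc. u k l) = (\<Sum>k\<in>Cc. t k j) + e"
      using i j finite_Cc unfolding u_def sum.distrib True bidders_eq by (simp add: column_eq[unfolded bidders_eq])
    then show ?thesis using e by simp
  next
    case False
    then show ?thesis using column_le[OF that] by (simp add: u_def column_eq)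
  qed
  then have "alloc_feasible Nc A Cc Ct u"
    using e i j t_nonneg by (auto simp: alloc_feasible_def u_def t_eq_0)
  from not_improvable[OF this]
  have "(\<Sum>k\<in>Cc. (I k - alloc k)\<^sup>2) \<le> (\<Sum>k\<in>Cc. (I k - allocated A D Ct p u k)\<^sup>2)" .
  moreover have "allocated A D Ct p u k = alloc k" if "k \<noteq> i" for k
    using that by (simp add: allocated_def u_def)
  moreover have "allocated A D Ct p u i = alloc i + e * D j p"
    by (rule allocated_update[OF j]) (auto simp: u_def)
  ultimately have "(I i - alloc i)\<^sup>2 \<le> (I i - alloc i - e * D j p)\<^sup>2"
    using i finite_Cc by (simp add: sum.remove[of Cc i] diff_diff_eq)
  moreover have "(I i - alloc i - e * D j p)\<^sup>2 < (I i - alloc i)\<^sup>2"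
    using eD by (intro power_strict_mono) auto
  ultimately show False by simp
qed

text \<open>
  Moving an amount \<open>x\<close> from a satisfied campaign to one with deficit \<open>g\<close> changes the objective by
  \<open>2 * x * (x - g)\<close>, which is negative for \<open>0 < x < g\<close>.
\<close>

lemma satisfied_unused:
  assumes i: "i \<in> Cc" and under: "alloc i < I i" and j: "j \<in> A i \<inter> Ct" and Dj: "0 < D j p"
    and k: "k \<in> Cc" and sat: "alloc k = I k"
  shows "t k j = 0"
proof (rule ccontr)
  assume "t k j \<noteq> 0"
  then have tk: "0 < t k j" using t_nonneg[of k j] by simp
  then have kj: "j \<in> A k \<inter> Ct" using t_eq_0[of k j] by force
  have ik: "i \<noteq> k" using under sat by auto
  \<comment> \<open>The bound \<open>t k j\<close> keeps the entry of \<open>k\<close> nonnegative;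
    halving the deficit makes the transferred amount \<open>e * D j p\<close> strictly smaller than
    it.\<close>
  define e where "e = min (t k j) ((I i - alloc i) / D j p / 2)"
  have e: "0 < e" "e \<le> t k j" "e \<le> (I i - alloc i) / D j p / 2"
    using tk under Dj by (auto simp: e_def)
  then have "e * D j p \<le> (I i - alloc i) / 2"
    using Dj by (auto simp: field_simps)
  then have eD: "0 < e * D j p" "e * D j p < I i - alloc i"
    using under e Dj by (auto intro: order.strict_trans1)
  \<comment> \<open>With two separate summands, \<open>sum.distrib\<close> splits the sum of column
    \<open>j\<close>, and the contributions \<open>e\<close> and \<open>- e\<close> cancel.\<close>
  define u where
    "u m l = t m l + (if m = i \<and> l = j then e else 0) + (if m = k \<and> l = j then - e else 0)" for m l
  have "(\<Sum>m\<in>bidders Nc A l \<inter> Cc. u m l) \<le> 1" if "l \<in> Ct" for l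
  proof (cases "l = j")
    case True
    have "(\<Sum>m\<in>bidders Nc A l \<inter> Cc. u m l) = (\<Sum>m\<in>Cc. t m j)"
      using i j k kj finite_Cc unfolding u_def sum.distrib True bidders_eq by (simp add: column_eq[unfolded bidders_eq])
    then show ?thesis using column_le[OF that] True by simp
  next
    case False
    then show ?thesis using column_le[OF that] by (simp add: u_def column_eq)
  qed
  moreover have "0 \<le> u m l" for m l
    using e t_nonneg[of m l] by (auto simp: u_def)
  ultimately have "alloc_feasible Nc A Cc Ct u"
    using i j k kj by (auto simp: alloc_feasible_def) (auto simp: u_def t_eq_0)
  from not_improvable[OF this]
  have "(\<Sum>m\<in>Cc. (I m - alloc m)\<^sup>2) \<le> (\<Sum>m\<in>Cc. (I m - allocated A D Ct p u m)\<^sup>2)" .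
  moreover have "(\<Sum>m\<in>Cc. f m) = f i + (f k + (\<Sum>m\<in>Cc - {i} - {k}. f m))" for f :: "nat \<Rightarrow> real"
    using i k ik finite_Cc by (simp add: sum.remove[of Cc i] sum.remove[of "Cc - {i}" k])
  moreover have "(\<Sum>m\<in>Cc - {i} - {k}. (I m - allocated A D Ct p u m)\<^sup>2)
      = (\<Sum>m\<in>Cc - {i} - {k}. (I m - alloc m)\<^sup>2)"
    by (intro sum.cong) (auto simp: allocated_def u_def)
  ultimately have "(I i - alloc i)\<^sup>2 + (I k - alloc k)\<^sup>2
      \<le> (I i - allocated A D Ct p u i)\<^sup>2 + (I k - allocated A D Ct p u k)\<^sup>2"
    by simp
  moreover have "allocated A D Ct p u i = alloc i + e * D j p"
    using ik by (intro allocated_update[OF j]) (auto simp: u_def)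
  moreover have "allocated A D Ct p u k = alloc k + (- e) * D j p"
    using ik by (intro allocated_update[OF kj]) (auto simp: u_def)
  ultimately have "0 \<le> 2 * (e * D j p) * (e * D j p - (I i - alloc i))"
    using sat by (simp add: power2_eq_square algebra_simps)
  then show False
    using eD by (simp add: zero_le_mult_iff)
qed

section \<open>Structure of the split\<close>

definition Cc1 :: "nat set" where
  "Cc1 = {i \<in> Cc. I i \<noteq> alloc i}"

definition Ct1 :: "nat set" where
  "Ct1 = Ct \<inter> (\<Union>i\<in>Cc1. A i)"

lemma Cc1_sub: "Cc1 \<subseteq> Cc"
  by (auto simp: Cc1_def)

lemma second_accessible: "Ct \<subseteq> (\<Union>i\<in>Cc. A i) \<Longrightarrow> Ct - Ct1 \<subseteq> (\<Union>i\<in>Cc - Cc1. A i)"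
  unfolding Ct1_def by blast

lemma Cc1_under: "i \<in> Cc1 \<Longrightarrow> alloc i < I i"
  using alloc_le[of i] by (simp add: Cc1_def)

text \<open>If \<open>D j p > 0\<close>, the column is full by \<open>full_column\<close>. The claim
  is about supply, not about column sums, because nothing forces a column to be full when
  \<open>D j p = 0\<close>; \<open>Ct1_satisfied\<close> carries the factor \<open>D j p\<close> for
  the same reason.\<close>

lemma Ct1_supply:
  assumes j: "j \<in> Ct1"
  shows "D j p = (\<Sum>k\<in>Cc. t k j * D j p)"
proof (cases "D j p = 0")
  case False
  then have "0 < D j p" using supply_price_nonneg j by (force simp: Ct1_def)
  moreover obtain i where i: "i \<in> Cc1" "j \<in> A i \<inter> Ct" using j by (auto simp: Ct1_def)
  ultimately have "(\<Sum>k\<in>Cc. t k j) = 1"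
    using Cc1_sub by (intro full_column[OF _ Cc1_under[OF i(1)] i(2)]) auto
  then show ?thesis by (simp flip: sum_distrib_right)
qed simp

lemma Ct1_satisfied:
  assumes j: "j \<in> Ct1" and k: "k \<in> Cc - Cc1"
  shows "t k j * D j p = 0"
proof (cases "D j p = 0")
  case False
  then have Dj: "0 < D j p" using supply_price_nonneg j by (force simp: Ct1_def)
  obtain i where i: "i \<in> Cc1" "j \<in> A i \<inter> Ct" using j by (auto simp: Ct1_def)
  have "k \<in> Cc" "alloc k = I k" using k by (auto simp: Cc1_def)
  then have "t k j = 0"
    using i(1) Cc1_sub by (intro satisfied_unused[OF _ Cc1_under[OF i(1)] i(2) Dj]) auto
  then show ?thesis by simp
qed simp

end

section \<open>Hall-type conditions and the price bounds they imply\<close>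

context market
begin

text \<open>Hall's condition with demands and supplies as weights, at price
  \<open>q\<close>.\<close>

definition demand_covered :: "nat set \<Rightarrow> nat set \<Rightarrow> real \<Rightarrow> bool" where
  "demand_covered Cc Ct q \<longleftrightarrow>
     (\<forall>S\<subseteq>Cc. (\<Sum>i\<in>S. I i) \<le> (\<Sum>j\<in>Ct \<inter> (\<Union>i\<in>S. A i). D j q))"

text \<open>The groups counted are those that no campaign of \<open>Cc\<close> outside
  \<open>W\<close> can use. With this complement form, removing \<open>Cc1\<close> and its groups
  does not change them for \<open>W\<close> inside the second half. The empty \<open>W\<close> is
  excluded, since its demand is 0.\<close>

definition supply_exhausted :: "nat set \<Rightarrow> nat set \<Rightarrow> real \<Rightarrow> bool" where
  "supply_exhausted Cc Ct q \<longleftrightarrow>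
     (\<forall>W\<subseteq>Cc. W \<noteq> {} \<longrightarrow> (\<Sum>j\<in>Ct - (\<Union>i\<in>Cc - W. A i). D j q) < (\<Sum>i\<in>W. I i))"

text \<open>Hall's condition for \<open>S = Cc\<close> contradicts the minimality of
  \<open>p\<close> if \<open>q < p\<close>.\<close>

lemma price_le:
  assumes "is_price I D Cc Ct p" and "demand_covered Cc Ct q" and "Ct \<subseteq> {1..Nr}" and "0 \<le> q"
  shows "p \<le> q"
proof (rule ccontr)
  assume "\<not> p \<le> q"
  then have "(\<Sum>j\<in>Ct. D j q) < (\<Sum>i\<in>Cc. I i)"
    using assms by (auto simp: is_price_def)
  also have "\<dots> \<le> (\<Sum>j\<in>Ct \<inter> (\<Union>i\<in>Cc. A i). D j q)"
    using assms by (simp add: demand_covered_def)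
  also have "\<dots> \<le> (\<Sum>j\<in>Ct. D j q)"
    using assms by (intro sum_mono2 supply_nonneg[OF supply_D]) (auto intro: finite_subset)
  finally show False by simp
qed

lemma price_gt:
  assumes price: "is_price I D Cc Ct p" and exhausted: "supply_exhausted Cc Ct q"
    and Ct: "Ct \<subseteq> {1..Nr}" and "Cc \<noteq> {}"
  shows "q < p"
proof (rule ccontr)
  assume "\<not> q < p"
  then have pq: "0 \<le> p" "p \<le> q" using price by (simp_all add: is_price_def)
  have "(\<Sum>i\<in>Cc. I i) \<le> (\<Sum>j\<in>Ct. D j p)"
    using price by (simp add: is_price_def)
  also have "\<dots> \<le> (\<Sum>j\<in>Ct. D j q)"
    using Ct pq by (intro sum_mono supply_mono[OF supply_D]) auto
  \<comment> \<open>For \<open>W = Cc\<close> no group is removed, so the condition speaks of the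
    whole of \<open>Ct\<close>.\<close>
  also have "\<dots> < (\<Sum>i\<in>Cc. I i)"
    using exhausted[unfolded supply_exhausted_def, rule_format, of Cc] \<open>Cc \<noteq> {}\<close> by simp
  finally show False by simp
qed

end

section \<open>Hall-type conditions for the two halves of a split\<close>

context allocation
begin

text \<open>The groups in question are sold out at \<open>p\<close> and sold only to campaigns in
  \<open>W\<close>, each of which still has a deficit.\<close>

lemma first_exhausted: "supply_exhausted Cc1 Ct1 p"
  unfolding supply_exhausted_def
proof (intro allI impI)
  fix W assume W: "W \<subseteq> Cc1" "W \<noteq> {}"
  define T where "T = Ct1 - (\<Union>i\<in>Cc1 - W. A i)"
  have WCc: "W \<subseteq> Cc" using W Cc1_sub by blast
  have "(\<Sum>j\<in>T. D j p) = (\<Sum>j\<in>T. \<Sum>k\<in>W. t k j * D j p)"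
  proof (rule sum.cong[OF refl])
    fix j assume j: "j \<in> T"
    \<comment> \<open>Campaigns in \<open>Cc1 - W\<close> have no access to \<open>j\<close>;
      satisfied campaigns obtain nothing from \<open>Ct1\<close>.\<close>
    have "t k j * D j p = 0" if k: "k \<in> Cc - W" for k
    proof (cases "k \<in> Cc1")
      case True
      then have "t k j = 0" using j k by (intro t_eq_0) (auto simp: T_def)
      then show ?thesis by simp
    next
      case False
      then show ?thesis using j k by (intro Ct1_satisfied) (auto simp: T_def)
    qed
    then have "(\<Sum>k\<in>W. t k j * D j p) = (\<Sum>k\<in>Cc. t k j * D j p)"
      using WCc by (intro sum.mono_neutral_left finite_Cc) auto
    then show "D j p = (\<Sum>k\<in>W. t k j * D j p)"
      using Ct1_supply[of j] j by (simp add: T_def)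
  qed
  also have "\<dots> = (\<Sum>k\<in>W. \<Sum>j\<in>T. t k j * D j p)"
    by (rule sum.swap)
  also have "\<dots> \<le> (\<Sum>k\<in>W. alloc k)"
    unfolding alloc_eq using supply_price_nonneg t_nonneg
    by (intro sum_mono sum_mono2 finite_Ct) (auto simp: T_def Ct1_def)
  also have "\<dots> < (\<Sum>k\<in>W. I k)"
    using W WCc finite_Cc Cc1_under by (intro sum_strict_mono) (auto intro: finite_subset)
  finally show "(\<Sum>j\<in>Ct1 - (\<Union>i\<in>Cc1 - W. A i). D j p) < (\<Sum>i\<in>W. I i)"
    by (simp add: T_def)
qed

text \<open>The allocation \<open>t\<close> itself is the witness: it meets the demand of satisfied
  campaigns exactly, and only through accessible groups outside \<open>Ct1\<close>.\<close>

lemma second_covered: "demand_covered (Cc - Cc1) (Ct - Ct1) p"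
  unfolding demand_covered_def
proof (intro allI impI)
  fix S assume S: "S \<subseteq> Cc - Cc1"
  define T where "T = (Ct - Ct1) \<inter> (\<Union>i\<in>S. A i)"
  have "(\<Sum>i\<in>S. I i) = (\<Sum>i\<in>S. alloc i)"
    using S by (intro sum.cong) (auto simp: Cc1_def)
  also have "\<dots> = (\<Sum>i\<in>S. \<Sum>j\<in>T. t i j * D j p)"
  proof (rule sum.cong[OF refl])
    fix i assume i: "i \<in> S"
    have "t i j * D j p = 0" if "j \<in> Ct - T" for j
    proof (cases "j \<in> Ct1")
      case True
      then show ?thesis using i S by (intro Ct1_satisfied) auto
    next
      case False
      then have "t i j = 0" using that i by (intro t_eq_0) (auto simp: T_def)
      then show ?thesis by simp
    qed
    then show "alloc i = (\<Sum>j\<in>T. t i j * D j p)"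
      unfolding alloc_eq by (intro sum.mono_neutral_right finite_Ct) (auto simp: T_def)
  qed
  also have "\<dots> = (\<Sum>j\<in>T. (\<Sum>i\<in>S. t i j) * D j p)"
    by (subst sum.swap) (simp add: sum_distrib_right)
  also have "\<dots> \<le> (\<Sum>j\<in>T. 1 * D j p)"
  proof (intro sum_mono mult_right_mono)
    fix j assume j: "j \<in> T"
    then have jCt: "j \<in> Ct" by (simp add: T_def)
    then show "0 \<le> D j p" by (rule supply_price_nonneg)
    have "(\<Sum>i\<in>S. t i j) \<le> (\<Sum>i\<in>Cc. t i j)"
      using S t_nonneg by (intro sum_mono2 finite_Cc) auto
    then show "(\<Sum>i\<in>S. t i j) \<le> 1"
      using column_le[OF jCt] by simp
  qed
  finally show "(\<Sum>i\<in>S. I i) \<le> (\<Sum>j\<in>(Ct - Ct1) \<inter> (\<Union>i\<in>S. A i). D j p)"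
    by (simp add: T_def)
qed

text \<open>Otherwise the first half would be all of \<open>(Cc, Ct)\<close>, hence exhausted at its
  own price \<open>p\<close>, and \<open>price_gt\<close> would give \<open>p < p\<close>.\<close>

lemma second_nonempty:
  assumes "Ct \<subseteq> (\<Union>i\<in>Cc. A i)" and "alloc_value I A D Cc Ct p t \<noteq> 0"
  shows "Cc - Cc1 \<noteq> {}"
proof
  assume "Cc - Cc1 = {}"
  then have eq: "Cc1 = Cc" "Ct1 = Ct" using assms Cc1_sub by (auto simp: Ct1_def)
  have "Cc \<noteq> {}" using assms(2) by (auto simp: alloc_value_def)
  then have "p < p" using price_gt[OF price _ Ct] first_exhausted unfolding eq by blast
  then show False by simp
qed

end

section \<open>Bid values along the recursion and assembly of the dual prices\<close>

context market
begin

lemma rec_output_finite: "rec_output Nc I A D Cc Ct out \<Longrightarrow> finite out"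
  by (induction rule: rec_output.induct) auto

lemma rec_output_price_nonneg: "rec_output Nc I A D Cc Ct out \<Longrightarrow> q \<in> fst ` out \<Longrightarrow> 0 \<le> q"
  by (induction rule: rec_output.induct) (auto simp: is_price_def)

lemma rec_output_prices_le:
  assumes "rec_output Nc I A D Cc Ct out" and "Cc \<subseteq> {1..Nc}" and "Ct \<subseteq> {1..Nr}"
    and "demand_covered Cc Ct q" and "0 \<le> q" and "r \<in> fst ` out"
  shows "r \<le> q"
  using assms
proof (induction arbitrary: q rule: rec_output.induct)
  case (stop Cc Ct p t)
  then show ?case using price_le by simp
next
  case (split Cc Ct p t Cc1 Ct1 out1 out2)
  interpret allocation Nc Nr I A D Cc Ct p t
    using split by unfold_locales auto
  have Cc1: "Cc1 = local.Cc1" and Ct1: "Ct1 = local.Ct1"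
    using split by (auto simp: local.Cc1_def local.Ct1_def)
  consider "r \<in> fst ` out1" | "r \<in> fst ` out2" using split.prems by auto
  then show ?case
  proof cases
    case 1
    \<comment> \<open>The first half inherits Hall's condition at \<open>q\<close>, because
      \<open>Ct1\<close> keeps every group of \<open>Ct\<close> that \<open>Cc1\<close> can
      reach.\<close>
    have "demand_covered Cc1 Ct1 q"
      unfolding demand_covered_def
    proof (intro allI impI)
      fix S assume S: "S \<subseteq> Cc1"
      then have "Ct1 \<inter> (\<Union>i\<in>S. A i) = Ct \<inter> (\<Union>i\<in>S. A i)" "S \<subseteq> Cc"
        using split.hyps(4,5) by blast+
      then show "(\<Sum>i\<in>S. I i) \<le> (\<Sum>j\<in>Ct1 \<inter> (\<Union>i\<in>S. A i). D j q)"
        using split.prems by (simp add: demand_covered_def)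
    qed
    then show ?thesis
      using 1 split.prems split.hyps by (intro split.IH(1)) auto
  next
    case 2
    have p0: "0 \<le> p" using price by (simp add: is_price_def)
    \<comment> \<open>The induction hypothesis is applied with the split price \<open>p\<close> in
      place of \<open>q\<close>, which is why \<open>q\<close> is kept arbitrary.\<close>
    have "r \<le> p"
      using second_covered[folded Cc1 Ct1] split.prems 2 p0 by (intro split.IH(2)) auto
    also have "p \<le> q"
      using price_le[OF price] split.prems by blast
    finally show ?thesis .
  qed
qed

text \<open>The roles of the halves are reversed: the first is exhausted at its split price
  \<open>p > q\<close>, while the second inherits exhaustion at \<open>q\<close>. Accessibility of
  all groups keeps the second half nonempty, as \<open>price_gt\<close> requires.\<close>

lemma rec_output_prices_gt:
  assumes "rec_output Nc I A D Cc Ct out" and "Cc \<subseteq> {1..Nc}" and "Ct \<subseteq> {1..Nr}"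
    and "Ct \<subseteq> (\<Union>i\<in>Cc. A i)" and "Cc \<noteq> {}"
    and "supply_exhausted Cc Ct q" and "r \<in> fst ` out"
  shows "q < r"
  using assms
proof (induction arbitrary: q rule: rec_output.induct)
  case (stop Cc Ct p t)
  then show ?case using price_gt by simp
next
  case (split Cc Ct p t Cc1 Ct1 out1 out2)
  interpret allocation Nc Nr I A D Cc Ct p t
    using split by unfold_locales auto
  have Cc1: "Cc1 = local.Cc1" and Ct1: "Ct1 = local.Ct1"
    using split by (auto simp: local.Cc1_def local.Ct1_def)
  consider "r \<in> fst ` out1" | "r \<in> fst ` out2" using split.prems by auto
  then show ?case
  proof cases
    case 1
    have "q < p"
      using price_gt[OF price] split.prems by blast
    also have "Cc1 \<noteq> {}"
      using split.hyps by (auto simp: alloc_value_def)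
    then have "p < r"
      using first_exhausted[folded Cc1 Ct1] split.prems split.hyps 1 by (intro split.IH(1)) auto
    finally show ?thesis .
  next
    case 2
    have "supply_exhausted (Cc - Cc1) (Ct - Ct1) q"
      unfolding supply_exhausted_def
    proof (intro allI impI)
      fix W assume W: "W \<subseteq> Cc - Cc1" "W \<noteq> {}"
      then have "Ct - Ct1 - (\<Union>i\<in>Cc - Cc1 - W. A i) = Ct - (\<Union>i\<in>Cc - W. A i)" "W \<subseteq> Cc"
        using split.hyps(4,5) by blast+
      then show "(\<Sum>j\<in>Ct - Ct1 - (\<Union>i\<in>Cc - Cc1 - W. A i). D j q) < (\<Sum>i\<in>W. I i)"
        using W split.prems by (simp add: supply_exhausted_def)
    qed
    moreover have "Cc - Cc1 \<noteq> {}"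
      using second_nonempty[folded Cc1] split.prems split.hyps by blast
    moreover have "Ct - Ct1 \<subseteq> (\<Union>i\<in>Cc - Cc1. A i)"
      using second_accessible[folded Cc1 Ct1] split.prems(3) by blast
    ultimately show ?thesis
      using 2 split.prems by (intro split.IH(2)) auto
  qed
qed

text \<open>The summand of the lower bound as a function of the triple, so that the induction can
  sum over \<open>out\<close> directly, without the description in \<open>component\<close>.\<close>

definition component_value :: "real \<times> nat set \<times> nat set \<Rightarrow> real" where
  "component_value = (\<lambda>(p, Cc, Ct).
     (\<Sum>i\<in>Cc. I i) * p - integral {0..p} (\<lambda>b. \<Sum>j\<in>Ct. D j b))"

lemma component_value_eq:
  assumes "Ct \<subseteq> {1..Nr}"
  shows "component_value (p, Cc, Ct) = (\<Sum>i\<in>Cc. I i * p) - (\<Sum>j\<in>Ct. integral {0..p} (D j))"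
proof -
  have "integral {0..p} (\<lambda>b. \<Sum>j\<in>Ct. D j b) = (\<Sum>j\<in>Ct. integral {0..p} (D j))"
    using assms supply_D by (intro integral_sum supply_integrable) (auto intro: finite_subset)
  then show ?thesis by (simp add: component_value_def sum_distrib_right)
qed

text \<open>The prices of the two halves are glued together. Injectivity of \<open>fst\<close> is
  carried along, since the split price \<open>p\<close> separates the bid values of the
  halves.\<close>

lemma rec_output_dual_prices:
  assumes "rec_output Nc I A D Cc Ct out" and "Cc \<subseteq> {1..Nc}" and "Ct \<subseteq> {1..Nr}"
    and "Ct \<subseteq> (\<Union>i\<in>Cc. A i)"
  shows "inj_on fst out \<and> (\<exists>\<kappa> \<mu>. \<kappa> ` Cc \<subseteq> fst ` out \<and> \<mu> ` Ct \<subseteq> fst ` out \<and>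
     (\<forall>i\<in>Cc. \<forall>j\<in>A i \<inter> Ct. \<kappa> i \<le> \<mu> j) \<and>
     (\<Sum>c\<in>out. component_value c) =
       (\<Sum>i\<in>Cc. I i * \<kappa> i) - (\<Sum>j\<in>Ct. integral {0..\<mu> j} (D j)))"
  using assms
proof (induction rule: rec_output.induct)
  case (stop Cc Ct p t)
  then show ?case
    by (intro conjI exI[of _ "\<lambda>_. p"]) (auto simp: component_value_eq)
next
  case (split Cc Ct p t Cc1 Ct1 out1 out2)
  interpret allocation Nc Nr I A D Cc Ct p t
    using split by unfold_locales auto
  have Cc1: "Cc1 = local.Cc1" and Ct1: "Ct1 = local.Ct1"
    using split by (auto simp: local.Cc1_def local.Ct1_def)
  have sub: "Cc1 \<subseteq> Cc" "Ct1 \<subseteq> Ct" "Cc1 \<subseteq> {1..Nc}" "Ct1 \<subseteq> {1..Nr}"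
    "Cc - Cc1 \<subseteq> {1..Nc}" "Ct - Ct1 \<subseteq> {1..Nr}"
    "Ct1 \<subseteq> (\<Union>i\<in>Cc1. A i)" "Ct - Ct1 \<subseteq> (\<Union>i\<in>Cc - Cc1. A i)"
    using split.hyps(4,5) split.prems second_accessible[folded Cc1 Ct1] by blast+
  have p0: "0 \<le> p" using price by (simp add: is_price_def)
  have "Cc1 \<noteq> {}"
    using split.hyps by (auto simp: alloc_value_def)
  then have gt: "p < r" if "r \<in> fst ` out1" for r
    using rec_output_prices_gt[OF split.hyps(6) sub(3,4,7)] first_exhausted[folded Cc1 Ct1] that by blast
  have le: "r \<le> p" if "r \<in> fst ` out2" for r
    using rec_output_prices_le[OF split.hyps(7) sub(5,6)] second_covered[folded Cc1 Ct1] p0 that by blast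
  have disj: "fst ` out1 \<inter> fst ` out2 = {}"
    using gt le by fastforce
  from split.IH(1)[OF sub(3,4,7)] obtain \<kappa>1 \<mu>1 where 1: "inj_on fst out1"
    "\<kappa>1 ` Cc1 \<subseteq> fst ` out1" "\<mu>1 ` Ct1 \<subseteq> fst ` out1" "\<forall>i\<in>Cc1. \<forall>j\<in>A i \<inter> Ct1. \<kappa>1 i \<le> \<mu>1 j"
    "(\<Sum>c\<in>out1. component_value c) =
       (\<Sum>i\<in>Cc1. I i * \<kappa>1 i) - (\<Sum>j\<in>Ct1. integral {0..\<mu>1 j} (D j))"
    by blast
  from split.IH(2)[OF sub(5,6,8)] obtain \<kappa>2 \<mu>2 where 2: "inj_on fst out2"
    "\<kappa>2 ` (Cc - Cc1) \<subseteq> fst ` out2" "\<mu>2 ` (Ct - Ct1) \<subseteq> fst ` out2"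
    "\<forall>i\<in>Cc - Cc1. \<forall>j\<in>A i \<inter> (Ct - Ct1). \<kappa>2 i \<le> \<mu>2 j"
    "(\<Sum>c\<in>out2. component_value c) =
       (\<Sum>i\<in>Cc - Cc1. I i * \<kappa>2 i) - (\<Sum>j\<in>Ct - Ct1. integral {0..\<mu>2 j} (D j))"
    by blast
  define \<kappa> where "\<kappa> i = (if i \<in> Cc1 then \<kappa>1 i else \<kappa>2 i)" for i
  define \<mu> where "\<mu> j = (if j \<in> Ct1 then \<mu>1 j else \<mu>2 j)" for j
  have "inj_on fst (out1 \<union> out2)"
    using 1(1) 2(1) disj by (auto simp: inj_on_Un)
  moreover have "\<kappa> ` Cc \<subseteq> fst ` (out1 \<union> out2)" "\<mu> ` Ct \<subseteq> fst ` (out1 \<union> out2)"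
    using 1(2,3) 2(2,3) unfolding \<kappa>_def \<mu>_def image_Un by (auto simp del: image_eqI)
  moreover have "\<kappa> i \<le> \<mu> j" if i: "i \<in> Cc" and j: "j \<in> A i \<inter> Ct" for i j
  proof (cases "j \<in> Ct1")
    case True
    show ?thesis
    proof (cases "i \<in> Cc1")
      case False
      \<comment> \<open>A satisfied campaign may have access to a group of the first half; the split
        price lies between their bid values.\<close>
      have "\<kappa>2 i \<le> p" using 2(2) i False by (intro le) auto
      also have "p < \<mu>1 j" using 1(3) True by (intro gt) auto
      finally show ?thesis using True False by (simp add: \<kappa>_def \<mu>_def)
    qed (use 1(4) True j in \<open>simp add: \<kappa>_def \<mu>_def\<close>)
  next
    case False
    \<comment> \<open>\<open>Ct1\<close> contains every group of \<open>Ct\<close> accessible to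
      \<open>Cc1\<close>, so the opposite mixed case cannot occur.\<close>
    then have "i \<notin> Cc1" using split.hyps j by auto
    then show ?thesis using 2(4) False i j by (simp add: \<kappa>_def \<mu>_def)
  qed
  moreover have "(\<Sum>c\<in>out1 \<union> out2. component_value c) =
      (\<Sum>i\<in>Cc. I i * \<kappa> i) - (\<Sum>j\<in>Ct. integral {0..\<mu> j} (D j))"
  proof -
    have "(\<Sum>c\<in>out1 \<union> out2. component_value c)
        = (\<Sum>c\<in>out1. component_value c) + (\<Sum>c\<in>out2. component_value c)"
      using split.hyps rec_output_finite disj by (intro sum.union_disjoint) auto
    moreover have "(\<Sum>i\<in>Cc. I i * \<kappa> i) = (\<Sum>i\<in>Cc - Cc1. I i * \<kappa> i) + (\<Sum>i\<in>Cc1. I i * \<kappa> i)"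
      using sub(1) finite_Cc by (rule sum.subset_diff)
    moreover have "(\<Sum>i\<in>Cc1. I i * \<kappa> i) = (\<Sum>i\<in>Cc1. I i * \<kappa>1 i)"
      "(\<Sum>i\<in>Cc - Cc1. I i * \<kappa> i) = (\<Sum>i\<in>Cc - Cc1. I i * \<kappa>2 i)"
      by (auto simp: \<kappa>_def)
    moreover have "(\<Sum>j\<in>Ct. integral {0..\<mu> j} (D j)) =
        (\<Sum>j\<in>Ct - Ct1. integral {0..\<mu> j} (D j)) + (\<Sum>j\<in>Ct1. integral {0..\<mu> j} (D j))"
      using sub(2) finite_Ct by (rule sum.subset_diff)
    moreover have "(\<Sum>j\<in>Ct1. integral {0..\<mu> j} (D j)) = (\<Sum>j\<in>Ct1. integral {0..\<mu>1 j} (D j))"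
      "(\<Sum>j\<in>Ct - Ct1. integral {0..\<mu> j} (D j)) = (\<Sum>j\<in>Ct - Ct1. integral {0..\<mu>2 j} (D j))"
      by (auto simp: \<mu>_def)
    ultimately show ?thesis using 1(5) 2(5) by simp
  qed
  ultimately show ?case by blast
qed

text \<open>Injectivity makes the description in \<open>component\<close> proper and permits
  reindexing along \<open>fst\<close>.\<close>

lemma sum_bid_values:
  assumes "inj_on fst out"
  shows "(\<Sum>p\<in>bid_values out. (\<Sum>i\<in>comp_campaigns out p. I i) * p
       - integral {0..p} (\<lambda>b. \<Sum>j\<in>comp_groups out p. D j b)) = (\<Sum>c\<in>out. component_value c)"
proof -
  have "component out (fst c) = snd c" if "c \<in> out" for c
    unfolding component_def
  proof (rule the_equality)
    show "(fst c, snd c) \<in> out" using that by simp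
    show "d = snd c" if "(fst c, d) \<in> out" for d
      using inj_onD[OF assms, of "(fst c, d)" c] that \<open>c \<in> out\<close> by (metis fst_conv snd_conv)
  qed
  then show ?thesis
    unfolding bid_values_def sum.reindex[OF assms]
    by (intro sum.cong) (auto simp: component_value_def comp_campaigns_def comp_groups_def)
qed

end

theorem proposition7:
  fixes Nc Nr :: nat
    and I :: "nat \<Rightarrow> real"
    and A :: "nat \<Rightarrow> nat set"
    and D :: "nat \<Rightarrow> real \<Rightarrow> real"
    and out :: "(real \<times> nat set \<times> nat set) set"
    and P :: "nat \<Rightarrow> nat \<Rightarrow> real set"
    and \<gamma> :: "nat \<Rightarrow> nat \<Rightarrow> real \<Rightarrow> real"
  assumes "\<And>i. i \<in> {1..Nc} \<Longrightarrow> I i \<ge> 0"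
    and "\<And>i. i \<in> {1..Nc} \<Longrightarrow> A i \<subseteq> {1..Nr}"
    and "\<And>j. j \<in> {1..Nr} \<Longrightarrow> bidders Nc A j \<noteq> {}"
    and "\<And>j. j \<in> {1..Nr} \<Longrightarrow> supply_curve (D j)"
    and "\<exists>b \<gamma>'. opt_feasible Nc Nr I A D b \<gamma>'"
    and "rec_output Nc I A D {1..Nc} {1..Nr} out"
    and "mixed_strategy Nc A P \<gamma>"
    and "mixed_solution Nc Nr I A D P \<gamma>"
  shows "mixed_cost Nc A D P \<gamma> \<ge>
    (\<Sum>p\<in>bid_values out.
       (\<Sum>i\<in>comp_campaigns out p. I i) * p
       - integral {0..p} (\<lambda>b. \<Sum>j\<in>comp_groups out p. D j b))"
proof -
  interpret market Nc Nr I A D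
    using assms(1,2,4) by unfold_locales
  have "{1..Nr} \<subseteq> (\<Union>i\<in>{1..Nc}. A i)"
    using assms(3) by (fastforce simp: bidders_def)
  from rec_output_dual_prices[OF assms(6) order_refl order_refl this]
  obtain \<kappa> \<mu> where out: "inj_on fst out" "\<kappa> ` {1..Nc} \<subseteq> fst ` out" "\<mu> ` {1..Nr} \<subseteq> fst ` out"
    and le: "\<forall>i\<in>{1..Nc}. \<forall>j\<in>A i \<inter> {1..Nr}. \<kappa> i \<le> \<mu> j"
    and val: "(\<Sum>c\<in>out. component_value c) =
       (\<Sum>i\<in>{1..Nc}. I i * \<kappa> i) - (\<Sum>j\<in>{1..Nr}. integral {0..\<mu> j} (D j))"
    by blast
  have "(\<Sum>c\<in>out. component_value c) \<le> mixed_cost Nc A D P \<gamma>"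
    unfolding val
  proof (rule weak_duality[OF assms(7,8)])
    show "0 \<le> \<kappa> i" if "i \<in> {1..Nc}" for i
      using rec_output_price_nonneg[OF assms(6)] out(2) that by blast
    show "0 \<le> \<mu> j" if "j \<in> {1..Nr}" for j
      using rec_output_price_nonneg[OF assms(6)] out(3) that by blast
    show "\<kappa> i \<le> \<mu> j" if "i \<in> {1..Nc}" "j \<in> A i" for i j
      using le assms(2) that by blast
  qed
  then show ?thesis by (simp only: sum_bid_values[OF out(1)])
qed

end
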